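(* Let $G=(V,E)$ be a directed graph on the (possibly infinite) action set $V$ with maximum out-degree $D<\infty$, let $\mathrm{root}\in V$ be any designated vertex, and let $L\ge 0$ be an integer. Suppose the utility functions satisfy $\max_{a,b\in V}|u^t(a)-u^t(b)|\le\Delta$ for all $t$. Then $(\Delta/(L+1),L)$-regret matching, after $T\ge 1$ steps, has expected local swap regret satisfying $$\frac1T\,\mathbb{E}\big[R^T_{\mathrm{localswap}}\big]\le \frac{\Delta}{L+1}+\frac{\Delta\sqrt{D\,|E_L|}}{\sqrt T},$$ where $E_L=\{(i,j)\in E:\ \ell(i)\le L\}$.
   Context: Online setting: at each time $t=1,2,\dots$ an action $a^t\in V$ is drawn from a distribution $\pi^t$ (chosen by the algorithm from the past), then a utility function $u^t:V\to\mathbb{R}$ is observed. The $u^t$ may depend arbitrarily on the past $a^1,\dots,a^{t-1},u^1,\dots,u^{t-1}$; given this past and $u^t$, the action $a^t$ has distribution $\pi^t$. Write $x^+=\max(x,0)$, $R^T_{a,b}=\sum_{t=1}^T\mathbf 1(a^t=a)(u^t(b)-u^t(a))$, and $R^T_{\mathrm{localswap}}=\sum_{a\in V}\max_{b:(a,b)\in E}(R^T_{a,b})^+$ (only finitely many nonzero terms). Level: $\ell(v)$ is the number of edges of a shortest directed path from $\mathrm{root}$ to $v$ ($\infty$ if none). Stationarity requirement with parameter $L$: given real numbers $\tilde R_{i,j}$, $(i,j)\in E$, put $M=\max_{(i,j)\in E}\tilde R^+_{i,j}$ (if $M=0$, all ratios $\tilde R^+_{i,j}/M$ are read as $0$). A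 vector $\pi=(\pi_j)_{j\in V}$ satisfies the requirement if (a) $\sum_{j\in V}\pi_j=1$ and $\pi_j\ge0$ for all $j$; (b) $\pi_j=0$ whenever $\ell(j)>L$; (c) for all $j$ with $1\le\ell(j)\le L$: $\pi_j=\sum_{i:(i,j)\in E}(\tilde R^+_{i,j}/M)\pi_i+\big(1-\sum_{k:(j,k)\in E}\tilde R^+_{j,k}/M\big)\pi_j$; (d) $\pi_{\mathrm{root}}=\sum_{i:(i,\mathrm{root})\in E}(\tilde R^+_{i,\mathrm{root}}/M)\pi_i+\sum_{j:\ell(j)=L+1}\sum_{i:(i,j)\in E}(\tilde R^+_{i,j}/M)\pi_i+\big(1-\sum_{j:(\mathrm{root},j)\in E}\tilde R^+_{\mathrm{root},j}/M\big)\pi_{\mathrm{root}}$; (e) if there is $j$ with $\pi_j>0$ and $\sum_{k:(j,k)\in E}\tilde R^+_{j,k}=0$, then $\sum_{k:(j,k)\in E}\tilde R^+_{j,k}=0$ for every $j$ with $\pi_j>0$. $(b,L)$-regret matching: initialize $\tilde R^0_{i,j}=0$ for all $(i,j)\in E$; at each time $t$ draw $a^t$ from some $\pi^t$ satisfying the requirement for the values $\tilde R^{t-1}_{i,j}$ with parameter $L$; after choosing $a^t=i$ and observing $u^t$, set $\tilde R^t_{i,j}=\tilde R^{t-1}_{i,j}+(u^t(j)-u^t(i)-b)$ for all $j$ with $(i,j)\in E$, and $\tilde R^t_{k,l}=\tilde R^{t-1}_{k,l}$ for all $(k,l)\in E$ with $k\ne i$. *)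

theory Defs
  imports
    "HOL-Probability.Probability"
    "HOL-Library.Extended_Nat"
begin

text \<open>
  A directed graph is a vertex set \<open>V\<close> together with \<open>E \<subseteq> V \<times> V\<close>; loops are allowed.
  The out-neighbours of \<open>v\<close> are \<open>E `` {v}\<close>, its in-neighbours are \<open>E\<inverse> `` {v}\<close>.
\<close>

definition has_max_out_degree :: "'v set \<Rightarrow> ('v \<times> 'v) set \<Rightarrow> nat \<Rightarrow> bool" where
  "has_max_out_degree V E D \<longleftrightarrow>
     (\<forall>v\<in>V. finite (E `` {v}) \<and> card (E `` {v}) \<le> D) \<and> (\<exists>v\<in>V. card (E `` {v}) = D)"

text \<open>
  \<open>(r, v) \<in> E ^^ n\<close> says that there is a walk with \<open>n\<close> edges from \<open>r\<close> to \<open>v\<close>; a shortest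
  walk is a path. The infimum of the empty set is \<open>\<infinity>\<close>.
\<close>

definition level :: "('v \<times> 'v) set \<Rightarrow> 'v \<Rightarrow> 'v \<Rightarrow> enat" where
  "level E r v = Inf {enat n |n. (r, v) \<in> E ^^ n}"

definition edges_upto_level :: "('v \<times> 'v) set \<Rightarrow> 'v \<Rightarrow> nat \<Rightarrow> ('v \<times> 'v) set" where
  "edges_upto_level E r L = {(i, j) \<in> E. level E r i \<le> enat L}"

definition pos :: "real \<Rightarrow> real" where
  "pos x = max x 0"

text \<open>
  The next three definitions concern a single trajectory \<open>x\<close> of actions and \<open>w\<close> of utility
  functions; times start at \<open>1\<close>.
  In \<open>local_swap_regret\<close>, inserting \<open>0\<close> does not change the maximum of the nonnegative
  numbers over a nonempty set of out-neighbours and gives a sink the contribution \<open>0\<close>.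
\<close>

definition regret :: "(nat \<Rightarrow> 'v) \<Rightarrow> (nat \<Rightarrow> 'v \<Rightarrow> real) \<Rightarrow> nat \<Rightarrow> 'v \<Rightarrow> 'v \<Rightarrow> real" where
  "regret x w T i j = (\<Sum>t = 1..T. of_bool (x t = i) * (w t j - w t i))"

definition local_swap_regret ::
  "'v set \<Rightarrow> ('v \<times> 'v) set \<Rightarrow> (nat \<Rightarrow> 'v) \<Rightarrow> (nat \<Rightarrow> 'v \<Rightarrow> real) \<Rightarrow> nat \<Rightarrow> real" where
  "local_swap_regret V E x w T =
     (\<Sum>\<^sub>\<infinity>i\<in>V. Max (insert 0 ((\<lambda>j. pos (regret x w T i j)) ` (E `` {i}))))"

fun biased_regret ::
  "real \<Rightarrow> (nat \<Rightarrow> 'v) \<Rightarrow> (nat \<Rightarrow> 'v \<Rightarrow> real) \<Rightarrow> nat \<Rightarrow> 'v \<Rightarrow> 'v \<Rightarrow> real" where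
  "biased_regret b x w 0 i j = 0"
| "biased_regret b x w (Suc t) i j =
     (if x (Suc t) = i
      then biased_regret b x w t i j + (w (Suc t) j - w (Suc t) i - b)
      else biased_regret b x w t i j)"

text \<open>
  The set of values in \<open>max_pos\<close> is finite whenever \<open>R\<close> vanishes outside the out-edges of
  finitely many vertices, as \<open>biased_regret\<close> does when out-degrees are finite; \<open>0\<close> is
  inserted only for the case \<open>E = {}\<close>.
  If \<open>max_pos E R = 0\<close>, then \<open>ratio E R i j = 0\<close>, since division by zero yields zero.
\<close>

definition max_pos :: "('v \<times> 'v) set \<Rightarrow> ('v \<Rightarrow> 'v \<Rightarrow> real) \<Rightarrow> real" where
  "max_pos E R = Max (insert 0 ((\<lambda>(i, j). pos (R i j)) ` E))"

definition ratio :: "('v \<times> 'v) set \<Rightarrow> ('v \<Rightarrow> 'v \<Rightarrow> real) \<Rightarrow> 'v \<Rightarrow> 'v \<Rightarrow> real" where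
  "ratio E R i j = pos (R i j) / max_pos E R"

text \<open>
  In-neighbourhoods may be infinite, hence the infinite sums over \<open>E\<inverse> `` {j}\<close>. When
  out-degrees are finite, only finitely many vertices have level at most \<open>L + 1\<close>, so these
  sums have only finitely many nonzero terms and the outer sum in the root equation is finite.
\<close>

definition stationary ::
  "'v set \<Rightarrow> ('v \<times> 'v) set \<Rightarrow> 'v \<Rightarrow> nat \<Rightarrow> ('v \<Rightarrow> 'v \<Rightarrow> real) \<Rightarrow> ('v \<Rightarrow> real) \<Rightarrow> bool" where
  "stationary V E r L R q \<longleftrightarrow>
     (q has_sum 1) V \<and> (\<forall>j\<in>V. 0 \<le> q j) \<and>
     (\<forall>j\<in>V. level E r j > enat L \<longrightarrow> q j = 0) \<and>
     (\<forall>j\<in>V. 1 \<le> level E r j \<and> level E r j \<le> enat L \<longrightarrow>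
        q j = (\<Sum>\<^sub>\<infinity>i\<in>E\<inverse> `` {j}. ratio E R i j * q i)
              + (1 - (\<Sum>k\<in>E `` {j}. ratio E R j k)) * q j) \<and>
     q r = (\<Sum>\<^sub>\<infinity>i\<in>E\<inverse> `` {r}. ratio E R i r * q i)
           + (\<Sum>j\<in>{j\<in>V. level E r j = enat (L + 1)}. \<Sum>\<^sub>\<infinity>i\<in>E\<inverse> `` {j}. ratio E R i j * q i)
           + (1 - (\<Sum>j\<in>E `` {r}. ratio E R r j)) * q r \<and>
     ((\<exists>j\<in>V. q j > 0 \<and> (\<Sum>k\<in>E `` {j}. pos (R j k)) = 0) \<longrightarrow>
      (\<forall>j\<in>V. q j > 0 \<longrightarrow> (\<Sum>k\<in>E `` {j}. pos (R j k)) = 0))"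

definition regret_matching ::
  "'v set \<Rightarrow> ('v \<times> 'v) set \<Rightarrow> 'v \<Rightarrow> real \<Rightarrow> nat \<Rightarrow>
   (nat \<Rightarrow> 'v) \<Rightarrow> (nat \<Rightarrow> 'v \<Rightarrow> real) \<Rightarrow> (nat \<Rightarrow> 'v \<Rightarrow> real) \<Rightarrow> bool" where
  "regret_matching V E r b L x w q \<longleftrightarrow>
     (\<forall>t\<ge>1. stationary V E r L (biased_regret b x w (t - 1)) (q t))"

text \<open>
  The history before time \<open>t\<close> is a random element of a product space, where \<open>V\<close> carries the
  discrete and \<open>V \<rightarrow> \<real>\<close> the product sigma-algebra. The sigma-algebras \<open>past\<close> and
  \<open>past_and_utility\<close> are those generated by the history before time \<open>t\<close> alone and by this
  history together with the utility function of time \<open>t\<close>.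
\<close>

definition utility_space :: "'v set \<Rightarrow> ('v \<Rightarrow> real) measure" where
  "utility_space V = Pi\<^sub>M V (\<lambda>_. borel)"

definition history_space :: "'v set \<Rightarrow> nat \<Rightarrow> (nat \<Rightarrow> 'v \<times> ('v \<Rightarrow> real)) measure" where
  "history_space V t = Pi\<^sub>M {1..<t} (\<lambda>_. count_space V \<Otimes>\<^sub>M utility_space V)"

definition history ::
  "'v set \<Rightarrow> (nat \<Rightarrow> 'w \<Rightarrow> 'v) \<Rightarrow> (nat \<Rightarrow> 'w \<Rightarrow> 'v \<Rightarrow> real) \<Rightarrow> nat \<Rightarrow> 'w \<Rightarrow> nat \<Rightarrow> 'v \<times> ('v \<Rightarrow> real)" where
  "history V a u t \<omega> = (\<lambda>s\<in>{1..<t}. (a s \<omega>, restrict (u s \<omega>) V))"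

definition past ::
  "'w measure \<Rightarrow> 'v set \<Rightarrow> (nat \<Rightarrow> 'w \<Rightarrow> 'v) \<Rightarrow> (nat \<Rightarrow> 'w \<Rightarrow> 'v \<Rightarrow> real) \<Rightarrow> nat \<Rightarrow> 'w measure" where
  "past M V a u t = vimage_algebra (space M) (history V a u t) (history_space V t)"

definition past_and_utility ::
  "'w measure \<Rightarrow> 'v set \<Rightarrow> (nat \<Rightarrow> 'w \<Rightarrow> 'v) \<Rightarrow> (nat \<Rightarrow> 'w \<Rightarrow> 'v \<Rightarrow> real) \<Rightarrow> nat \<Rightarrow> 'w measure" where
  "past_and_utility M V a u t =
     vimage_algebra (space M) (\<lambda>\<omega>. (history V a u t \<omega>, restrict (u t \<omega>) V))
       (history_space V t \<Otimes>\<^sub>M utility_space V)"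

text \<open>
  Here \<open>a t\<close> is the action, \<open>u t\<close> the utility function and \<open>p t\<close> the distribution chosen by
  the algorithm at time \<open>t \<ge> 1\<close>. The utility function may depend on the past and on
  additional randomness, and conditionally on the past and \<open>u t\<close> the action has law \<open>p t\<close>.
\<close>

locale online_play = prob_space M for M :: "'w measure" +
  fixes V :: "'v set"
    and a :: "nat \<Rightarrow> 'w \<Rightarrow> 'v"
    and u :: "nat \<Rightarrow> 'w \<Rightarrow> 'v \<Rightarrow> real"
    and p :: "nat \<Rightarrow> 'w \<Rightarrow> 'v \<Rightarrow> real"
  assumes action_measurable: "\<And>t. t \<ge> 1 \<Longrightarrow> a t \<in> measurable M (count_space V)"
    and utility_measurable: "\<And>t v. t \<ge> 1 \<Longrightarrow> v \<in> V \<Longrightarrow> (\<lambda>\<omega>. u t \<omega> v) \<in> borel_measurable M"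
    and distribution_from_past:
      "\<And>t v. t \<ge> 1 \<Longrightarrow> v \<in> V \<Longrightarrow> (\<lambda>\<omega>. p t \<omega> v) \<in> borel_measurable (past M V a u t)"
    and action_law:
      "\<And>t v. t \<ge> 1 \<Longrightarrow> v \<in> V \<Longrightarrow>
         AE \<omega> in M. real_cond_exp M (past_and_utility M V a u t)
           (indicator {\<omega> \<in> space M. a t \<omega> = v}) \<omega> = p t \<omega> v"

text \<open>
  The conditional law places \<open>a t\<close> in the finite support of \<open>p t\<close> only almost surely. For
  uncountable \<open>V\<close>, the local swap regret may therefore fail to be \<open>M\<close>-measurable on a null
  set, and its expectation is taken with respect to the completion of \<open>M\<close>; for \<open>M\<close>-measurable
  functions this is the same integral.
\<close>

definition expected_local_swap_regret ::
  "'w measure \<Rightarrow> 'v set \<Rightarrow> ('v \<times> 'v) set \<Rightarrow> (nat \<Rightarrow> 'w \<Rightarrow> 'v) \<Rightarrow> (nat \<Rightarrow> 'w \<Rightarrow> 'v \<Rightarrow> real) \<Rightarrow> nat \<Rightarrow> real" where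
  "expected_local_swap_regret M V E a u T =
     (\<integral>\<omega>. local_swap_regret V E (\<lambda>t. a t \<omega>) (\<lambda>t. u t \<omega>) T \<partial>completion M)"

end

theory Submission imports Defs begin

text \<open>
  This is Blackwell-style regret matching with the potential \<open>\<Sum> (pos R)\<^sup>2 + 2 b pos R\<close>
  of the biased regrets \<open>R\<close> on the edges out of level at most \<open>L\<close>. The weights
  \<open>ratio E R i j * q i\<close> of a stationary \<open>q\<close> form a flow that is conserved at every such vertex
  except the root, to which everything entering level \<open>L + 1\<close> returns. Its total utility gain is
  therefore collected only on returns, at most \<open>\<Delta>\<close> per unit, and every unit has used at least
  \<open>L + 1\<close> edges, each charged the bias \<open>b = \<Delta> / (L + 1)\<close>. So the expected first-order change of the
  potential is nonpositive, each step adds at most \<open>D \<Delta>\<^sup>2\<close>, and Cauchy--Schwarz turns the bound on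
  the potential into a bound on the sum of the positive biased regrets.
\<close>

section \<open>Levels and walk lengths\<close>

lemma level_le_iff: "level E r v \<le> enat n \<longleftrightarrow> (\<exists>m\<le>n. (r, v) \<in> E ^^ m)"
proof
  assume le: "level E r v \<le> enat n"
  let ?S = "{enat n |n. (r, v) \<in> E ^^ n}"
  have "?S \<noteq> {}"
  proof
    assume "?S = {}"
    hence "level E r v = \<infinity>" unfolding level_def by (simp only: Inf_enat_def) simp
    with le show False by simp
  qed
  then obtain x where "x \<in> ?S" by blast
  \<comment> \<open>The infimum of a nonempty set in the well-order \<open>enat\<close> is attained,
    which yields an actual walk of that length.\<close>
  hence "Inf ?S \<in> ?S" by (rule wellorder_InfI)
  with le show "\<exists>m\<le>n. (r, v) \<in> E ^^ m" unfolding level_def by auto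
next
  assume "\<exists>m\<le>n. (r, v) \<in> E ^^ m"
  then obtain m where m: "m \<le> n" "(r, v) \<in> E ^^ m" by blast
  have "level E r v \<le> enat m" unfolding level_def using m by (intro Inf_lower) auto
  also have "\<dots> \<le> enat n" using m by simp
  finally show "level E r v \<le> enat n" .
qed

lemma level_root [simp]: "level E r r = 0"
  using level_le_iff[of E r r 0] by (simp add: zero_enat_def[symmetric])

lemma level_eq_0_iff: "level E r v = 0 \<longleftrightarrow> v = r"
  using level_le_iff[of E r v 0] by (auto simp: zero_enat_def[symmetric])

lemma level_edge:
  assumes "(i, j) \<in> E" "level E r i \<le> enat n"
  shows "level E r j \<le> enat (Suc n)"
proof -
  obtain m where "m \<le> n" "(r, i) \<in> E ^^ m" using assms(2) unfolding level_le_iff by blast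
  hence "(r, j) \<in> E ^^ Suc m" using assms(1) by auto
  with \<open>m \<le> n\<close> show ?thesis unfolding level_le_iff by (intro exI[of _ "Suc m"]) auto
qed

section \<open>Finite balls around the root\<close>

locale rooted_graph =
  fixes V :: "'v set" and E :: "('v \<times> 'v) set" and root :: 'v
  assumes edges: "E \<subseteq> V \<times> V" and root_in: "root \<in> V"
    and finite_out: "v \<in> V \<Longrightarrow> finite (E `` {v})"
begin

text \<open>The index set that replaces the possibly infinite \<open>V\<close>: it is finite, and
  for \<open>n = L\<close> it carries all the mass of a stationary vector.\<close>

definition near :: "nat \<Rightarrow> 'v set" where
  "near n = {v. level E root v \<le> enat n}"

lemma root_in_near: "root \<in> near n"
  by (simp add: near_def)

lemma near_Suc_cases: "v \<in> near (Suc n) \<longleftrightarrow> v \<in> near n \<or> level E root v = enat (Suc n)"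
  by (cases "level E root v") (auto simp: near_def)

lemma near_edge: "i \<in> near n \<Longrightarrow> (i, j) \<in> E \<Longrightarrow> j \<in> near (Suc n)"
  using level_edge by (fastforce simp: near_def)

lemma near_subset: "near n \<subseteq> V"
proof
  fix v assume "v \<in> near n"
  then obtain m where "(root, v) \<in> E ^^ m" by (auto simp: near_def level_le_iff)
  thus "v \<in> V" using edges root_in by (cases m) auto
qed

text \<open>Each step passes from a finite set to a finite union of out-neighbourhoods. Containment
  in \<open>V\<close> is carried through the induction because \<open>finite_out\<close> speaks only
  of vertices in \<open>V\<close>.\<close>

lemma finite_walk_ends: "finite ((E ^^ m) `` {root}) \<and> (E ^^ m) `` {root} \<subseteq> V"
proof (induction m)
  case (Suc m)
  have "(E ^^ Suc m) `` {root} = (\<Union>v\<in>(E ^^ m) `` {root}. E `` {v})" by auto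
  with Suc show ?case using finite_out edges by auto
qed (use root_in in auto)

lemma finite_near: "finite (near n)"
proof -
  have "near n = (\<Union>m\<in>{..n}. (E ^^ m) `` {root})" by (auto simp: near_def level_le_iff)
  thus ?thesis using finite_walk_ends by simp
qed

lemma edges_upto_level_eq: "edges_upto_level E root n = Sigma (near n) (\<lambda>i. E `` {i})"
  by (auto simp: edges_upto_level_def near_def)

lemma finite_out_near: "i \<in> near n \<Longrightarrow> finite (E `` {i})"
  using near_subset finite_out by blast

lemma sum_edges_upto_level:
  "(\<Sum>(i, j)\<in>edges_upto_level E root n. g i j) = (\<Sum>i\<in>near n. \<Sum>j\<in>E `` {i}. g i j)"
  unfolding edges_upto_level_eq using finite_near finite_out_near by (subst sum.Sigma) auto

section \<open>Stationary vectors as flows\<close>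

lemma stationary_support: "stationary V E root L R q \<Longrightarrow> j \<in> V \<Longrightarrow> j \<notin> near L \<Longrightarrow> q j = 0"
  by (auto simp: stationary_def near_def not_le)

lemma stationary_nonneg: "stationary V E root L R q \<Longrightarrow> j \<in> V \<Longrightarrow> 0 \<le> q j"
  by (auto simp: stationary_def)

lemma stationary_sum:
  assumes "stationary V E root L R q"
  shows "(\<Sum>j\<in>near L. q j) = 1"
proof -
  have "(q has_sum 1) V" using assms by (simp add: stationary_def)
  hence "(q has_sum 1) (near L)"
    using stationary_support[OF assms] near_subset by (subst (asm) has_sum_cong_neutral[where T = "near L"]) auto
  thus ?thesis using finite_near has_sum_finite_iff by metis
qed

text \<open>Summation by parts: the coefficient of \<open>h v\<close> on the left is inflow minus
  outflow at \<open>v\<close>. It vanishes on \<open>near L\<close> away from the root, and at the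
  root it is minus the flow into level \<open>Suc L\<close>. The function \<open>h\<close> is
  arbitrary so that both the utility and the level can be inserted.\<close>

lemma stationary_flow:
  fixes h :: "'v \<Rightarrow> real"
  assumes st: "stationary V E root L R q"
  shows "(\<Sum>i\<in>near L. \<Sum>j\<in>E `` {i}. ratio E R i j * q i * (h j - h i)) =
         (\<Sum>j | level E root j = enat (Suc L). (\<Sum>i\<in>near L \<inter> E\<inverse> `` {j}. ratio E R i j * q i) * (h j - h root))"
proof -
  define f where "f i j = ratio E R i j * q i" for i j
  define inflow where "inflow j = (\<Sum>i\<in>near L \<inter> E\<inverse> `` {j}. f i j)" for j
  define outflow where "outflow i = (\<Sum>j\<in>E `` {i}. f i j)" for i
  define S where "S = {j. level E root j = enat (Suc L)}"
  have S_sub: "S \<subseteq> near (Suc L)" by (auto simp: S_def near_def)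
  have finS: "finite S" using S_sub finite_near finite_subset by blast
  have near_Suc: "near (Suc L) = near L \<union> S" by (auto simp: near_Suc_cases S_def)
  have disj: "near L \<inter> S = {}" by (auto simp: near_def S_def)
  \<comment> \<open>In-neighbourhoods may be infinite, but \<open>q\<close> vanishes outside
    \<open>near L\<close>.\<close>
  have infl: "(\<Sum>\<^sub>\<infinity>i\<in>E\<inverse> `` {j}. ratio E R i j * q i) = inflow j" for j
  proof -
    have "(\<Sum>\<^sub>\<infinity>i\<in>E\<inverse> `` {j}. f i j) = (\<Sum>\<^sub>\<infinity>i\<in>near L \<inter> E\<inverse> `` {j}. f i j)"
      using stationary_support[OF st] edges by (intro infsum_cong_neutral) (auto simp: f_def)
    thus ?thesis using finite_near by (simp add: f_def inflow_def)
  qed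
  have outfl: "(1 - (\<Sum>k\<in>E `` {j}. ratio E R j k)) * q j = q j - outflow j" for j
    by (simp add: outflow_def f_def left_diff_distrib sum_distrib_right)
  have S_V: "{j\<in>V. level E root j = enat (L + 1)} = S"
    using S_sub near_subset by (auto simp: S_def)
  \<comment> \<open>The term \<open>q j\<close> cancels in the stationarity equation, leaving
    conservation of flow. Only the root has level 0, so the equation for levels from 1 to
    \<open>L\<close> applies.\<close>
  have cons: "inflow j = outflow j" if "j \<in> near L" "j \<noteq> root" for j
  proof -
    have "level E root j \<noteq> 0" using that by (simp add: level_eq_0_iff)
    hence "1 \<le> level E root j" by (simp add: ileI1 one_eSuc)
    moreover have "j \<in> V" "level E root j \<le> enat L" using that near_subset by (auto simp: near_def)
    ultimately have "q j = inflow j + (q j - outflow j)"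
      using st unfolding stationary_def infl outfl by blast
    thus ?thesis by simp
  qed
  have rt: "outflow root = inflow root + (\<Sum>j\<in>S. inflow j)"
  proof -
    have "q root = inflow root + (\<Sum>j\<in>S. inflow j) + (q root - outflow root)"
      using st unfolding stationary_def infl outfl S_V by blast
    thus ?thesis by simp
  qed
  \<comment> \<open>Regroup the edges by their head, which lies in the finite set
    \<open>near (Suc L)\<close>.\<close>
  have "(\<Sum>i\<in>near L. \<Sum>j\<in>E `` {i}. f i j * h j) = (\<Sum>i\<in>near L. \<Sum>j\<in>{j \<in> near (Suc L). (i, j) \<in> E}. f i j * h j)"
    by (intro sum.cong refl) (auto dest: near_edge)
  also have "\<dots> = (\<Sum>j\<in>near (Suc L). \<Sum>i\<in>{i\<in>near L. (i, j) \<in> E}. f i j * h j)"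
    by (rule sum.swap_restrict) (auto simp: finite_near)
  also have "\<dots> = (\<Sum>j\<in>near (Suc L). inflow j * h j)"
    by (intro sum.cong refl) (auto simp: inflow_def sum_distrib_right intro!: sum.cong)
  also have "\<dots> = inflow root * h root + (\<Sum>j\<in>near L - {root}. inflow j * h j) + (\<Sum>j\<in>S. inflow j * h j)"
    unfolding near_Suc using disj finS finite_near root_in_near
    by (simp add: sum.union_disjoint sum.remove[of "near L" root])
  also have "(\<Sum>j\<in>near L - {root}. inflow j * h j) = (\<Sum>j\<in>near L - {root}. outflow j * h j)"
    using cons by (intro sum.cong) auto
  finally have 1: "(\<Sum>i\<in>near L. \<Sum>j\<in>E `` {i}. f i j * h j) =
     inflow root * h root + (\<Sum>j\<in>near L - {root}. outflow j * h j) + (\<Sum>j\<in>S. inflow j * h j)" .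
  have "(\<Sum>i\<in>near L. \<Sum>j\<in>E `` {i}. f i j * h i) = (\<Sum>i\<in>near L. outflow i * h i)"
    by (simp add: outflow_def sum_distrib_right)
  also have "\<dots> = outflow root * h root + (\<Sum>j\<in>near L - {root}. outflow j * h j)"
    using finite_near root_in_near by (simp add: sum.remove[of "near L" root])
  finally have 2: "(\<Sum>i\<in>near L. \<Sum>j\<in>E `` {i}. f i j * h i) =
     outflow root * h root + (\<Sum>j\<in>near L - {root}. outflow j * h j)" .
  have "(\<Sum>i\<in>near L. \<Sum>j\<in>E `` {i}. f i j * (h j - h i)) = (\<Sum>j\<in>S. inflow j * h j) - (\<Sum>j\<in>S. inflow j) * h root"
    using 1 2 rt by (simp add: right_diff_distrib sum_subtractf algebra_simps)
  also have "\<dots> = (\<Sum>j\<in>S. inflow j * (h j - h root))"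
    by (simp add: right_diff_distrib sum_subtractf sum_distrib_right)
  finally show ?thesis by (simp add: f_def inflow_def S_def)
qed

text \<open>After \<open>max_pos E R\<close> is factored out, positive parts become flow weights. By
  \<open>stationary_flow\<close> applied to \<open>w\<close>, the gain is at most \<Delta> times the
  flow into level \<open>Suc L\<close>; applied to the level, it shows that this flow is at most the
  fraction \<open>1 / (L + 1)\<close> of the total \<open>F\<close>. The gain is thus at most the
  bias times \<open>F\<close>, which is what the subtracted term charges.\<close>

lemma stationary_drift:
  fixes w :: "'v \<Rightarrow> real"
  assumes st: "stationary V E root L R q"
    and w: "\<And>i j. i \<in> V \<Longrightarrow> j \<in> V \<Longrightarrow> \<bar>w i - w j\<bar> \<le> \<Delta>"
    and fin: "finite ((\<lambda>(i, j). pos (R i j)) ` E)"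
  shows "(\<Sum>i\<in>near L. q i * (\<Sum>j\<in>E `` {i}. pos (R i j) * (w j - w i - \<Delta> / real (L + 1)))) \<le> 0"
proof -
  define m where "m = max_pos E R"
  have m_ge: "pos (R i j) \<le> m" if "(i, j) \<in> E" for i j
    unfolding m_def max_pos_def using fin that by (intro Max_ge) force+
  have m0: "0 \<le> m" unfolding m_def max_pos_def using fin by (intro Max_ge) auto
  have pos0: "0 \<le> pos z" for z by (simp add: pos_def)
  \<comment> \<open>If \<open>m = 0\<close>, all positive parts on edges are zero, so both sides
    vanish and the value of the division by zero is consistent.\<close>
  have pos_eq: "pos (R i j) = m * ratio E R i j" if "(i, j) \<in> E" for i j
    using m_ge[OF that] pos0[of "R i j"] by (cases "m = 0") (auto simp: ratio_def m_def)
  have rat0: "0 \<le> ratio E R i j" for i j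
    using m0 pos0 by (simp add: ratio_def m_def)
  define F where "F = (\<Sum>i\<in>near L. \<Sum>j\<in>E `` {i}. ratio E R i j * q i)"
  define S where "S = {j. level E root j = enat (Suc L)}"
  define inflow where "inflow j = (\<Sum>i\<in>near L \<inter> E\<inverse> `` {j}. ratio E R i j * q i)" for j
  have q0: "0 \<le> q i" if "i \<in> near L" for i using stationary_nonneg[OF st] that near_subset by blast
  have in0: "0 \<le> inflow j" for j
    unfolding inflow_def using q0 rat0 by (intro sum_nonneg mult_nonneg_nonneg) auto
  have S_V: "S \<subseteq> V" using near_subset[of "Suc L"] by (auto simp: S_def near_def)
  have D0: "0 \<le> \<Delta>" using w[OF root_in root_in] by simp
  \<comment> \<open>Only vertices of finite level are evaluated below, where \<open>the_enat\<close>
    is the true level.\<close>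
  define lev where "lev v = real (the_enat (level E root v))" for v
  have lev_edge: "lev j - lev i \<le> 1" if "i \<in> near L" "(i, j) \<in> E" for i j
  proof -
    obtain k where k: "level E root i = enat k" using \<open>i \<in> near L\<close> by (cases "level E root i") (auto simp: near_def)
    then obtain k' where "level E root j = enat k'" "k' \<le> Suc k"
      using level_edge[OF \<open>(i, j) \<in> E\<close>, of root k] by (cases "level E root j") auto
    thus ?thesis using k by (simp add: lev_def)
  qed
  \<comment> \<open>From the root to level \<open>Suc L\<close> the level rises by
    \<open>L + 1\<close>, while a single edge raises it by at most 1; edges that lead back down only
    help.\<close>
  have "(\<Sum>j\<in>S. inflow j) * real (L + 1) = (\<Sum>j\<in>S. inflow j * (lev j - lev root))"
    by (simp add: sum_distrib_right S_def lev_def zero_enat_def)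
  also have "\<dots> = (\<Sum>i\<in>near L. \<Sum>j\<in>E `` {i}. ratio E R i j * q i * (lev j - lev i))"
    using stationary_flow[OF st, of lev] by (simp add: inflow_def S_def)
  also have "\<dots> \<le> (\<Sum>i\<in>near L. \<Sum>j\<in>E `` {i}. ratio E R i j * q i * 1)"
    using lev_edge q0 rat0 by (intro sum_mono mult_left_mono) auto
  also have "\<dots> = F" by (simp add: F_def)
  finally have len: "(\<Sum>j\<in>S. inflow j) * real (L + 1) \<le> F" .
  have "(\<Sum>i\<in>near L. \<Sum>j\<in>E `` {i}. ratio E R i j * q i * (w j - w i)) = (\<Sum>j\<in>S. inflow j * (w j - w root))"
    using stationary_flow[OF st, of w] by (simp add: inflow_def S_def)
  also have "\<dots> \<le> (\<Sum>j\<in>S. inflow j * \<Delta>)"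
  proof (intro sum_mono mult_left_mono in0)
    fix j assume "j \<in> S"
    thus "w j - w root \<le> \<Delta>" using w[of j root] root_in S_V by (auto simp: abs_le_iff)
  qed
  also have "\<dots> = \<Delta> / real (L + 1) * ((\<Sum>j\<in>S. inflow j) * real (L + 1))"
    by (simp add: sum_distrib_right[symmetric])
  also have "\<dots> \<le> \<Delta> / real (L + 1) * F"
    using len D0 by (intro mult_left_mono) auto
  finally have gain: "(\<Sum>i\<in>near L. \<Sum>j\<in>E `` {i}. ratio E R i j * q i * (w j - w i)) \<le> \<Delta> / real (L + 1) * F" .
  have "(\<Sum>i\<in>near L. q i * (\<Sum>j\<in>E `` {i}. pos (R i j) * (w j - w i - \<Delta> / real (L + 1)))) =
     (\<Sum>i\<in>near L. \<Sum>j\<in>E `` {i}. m * (ratio E R i j * q i * (w j - w i) - \<Delta> / real (L + 1) * (ratio E R i j * q i)))"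
    unfolding sum_distrib_left
    by (intro sum.cong refl) (simp add: pos_eq, simp add: algebra_simps)
  also have "\<dots> = m * ((\<Sum>i\<in>near L. \<Sum>j\<in>E `` {i}. ratio E R i j * q i * (w j - w i)) - \<Delta> / real (L + 1) * F)"
    unfolding F_def by (simp only: sum_distrib_left[symmetric] sum_subtractf)
  also have "\<dots> \<le> 0" using gain m0 by (intro mult_nonneg_nonpos) auto
  finally show ?thesis .
qed

end

section \<open>The scalar potential\<close>

lemma pos_nonneg [simp]: "0 \<le> pos x"
  by (simp add: pos_def)

lemma pos_le_abs: "pos x \<le> \<bar>x\<bar>"
  by (simp add: pos_def)

definition potential :: "real \<Rightarrow> real \<Rightarrow> real" where
  "potential b x = (pos x)\<^sup>2 + 2 * b * pos x"

lemma pos_sq_le_potential: "0 \<le> b \<Longrightarrow> (pos x)\<^sup>2 \<le> potential b x"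
  by (simp add: potential_def)

text \<open>
  With \<open>(pos x)\<^sup>2\<close> alone the error term would be \<open>(\<Delta> + b)\<^sup>2\<close>; completing the square
  to \<open>(pos x + b)\<^sup>2\<close> replaces \<open>y\<close> by \<open>y + b\<close>.
\<close>

lemma potential_step:
  assumes b: "0 \<le> b" and y: "\<bar>y + b\<bar> \<le> \<Delta>"
  shows "potential b (x + y) \<le> potential b x + 2 * pos x * y + \<Delta>\<^sup>2"
proof -
  define P where "P = pos x"
  have yD: "(y + b)\<^sup>2 \<le> \<Delta>\<^sup>2" using y by (metis abs_le_square_iff abs_ge_self order_trans)
  show ?thesis
  proof (cases "x + y \<le> 0")
    case True
    \<comment> \<open>The new potential is zero here, so the right-hand side only has to be
      nonnegative: it is a square plus a nonnegative remainder.\<close>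
    have "0 \<le> (P + (y + b))\<^sup>2 + (\<Delta>\<^sup>2 - (y + b)\<^sup>2)" using yD by simp
    also have "\<dots> = P\<^sup>2 + 2 * b * P + 2 * P * y + \<Delta>\<^sup>2" by (simp add: power2_eq_square algebra_simps)
    finally show ?thesis using True by (simp add: potential_def pos_def P_def)
  next
    case False
    have "x + y \<le> P + y" by (simp add: P_def pos_def)
    hence "(x + y)\<^sup>2 + 2 * b * (x + y) \<le> (P + y)\<^sup>2 + 2 * b * (P + y)"
      using False b by (intro add_mono power_mono mult_left_mono) auto
    also have "\<dots> = P\<^sup>2 + 2 * b * P + 2 * P * y + ((y + b)\<^sup>2 - b\<^sup>2)"
      by (simp add: power2_eq_square algebra_simps)
    also have "\<dots> \<le> P\<^sup>2 + 2 * b * P + 2 * P * y + \<Delta>\<^sup>2"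
      using yD zero_le_power2[of b] by linarith
    finally show ?thesis using False by (simp add: potential_def pos_def P_def)
  qed
qed

section \<open>Regret along a single trajectory\<close>

lemma biased_regret_eq_sum:
  "biased_regret b x w n i j = (\<Sum>t=1..n. of_bool (x t = i) * (w t j - w t i - b))"
  by (induction n) auto

lemma regret_eq_biased_regret:
  "regret x w n i j = biased_regret b x w n i j + b * (\<Sum>t=1..n. of_bool (x t = i))"
  unfolding regret_def biased_regret_eq_sum sum_distrib_left sum.distrib[symmetric]
  by (intro sum.cong refl) (simp add: algebra_simps)

lemma abs_biased_regret_le:
  assumes "\<And>t. 1 \<le> t \<Longrightarrow> \<bar>w t j - w t i - b\<bar> \<le> C" "0 \<le> C"
  shows "\<bar>biased_regret b x w n i j\<bar> \<le> real n * C"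
proof -
  have "\<bar>biased_regret b x w n i j\<bar> \<le> (\<Sum>t=1..n. C)"
    unfolding biased_regret_eq_sum using assms
    by (intro order_trans[OF sum_abs] sum_mono) (auto simp: of_bool_def)
  thus ?thesis by simp
qed

lemma sum_of_bool_le_1:
  assumes "finite A"
  shows "(\<Sum>i\<in>A. of_bool (x = i) :: real) \<le> 1"
proof -
  have "(\<Sum>i\<in>A. of_bool (x = i) :: real) = (\<Sum>i\<in>A. if x = i then 1 else 0)" by (intro sum.cong) auto
  also have "\<dots> \<le> 1" using assms by simp
  finally show ?thesis .
qed

text \<open>Preimages under \<open>f\<close> and \<open>g\<close> differ only inside a null set, and
  the completion contains every subset of a null set. This serves the local swap regret, which is
  tied to an \<open>M\<close>-measurable function only almost surely.\<close>

lemma measurable_completion_cong_AE: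
  assumes g: "g \<in> measurable M N" and AE: "AE x in M. f x = g x" and f: "f \<in> space M \<rightarrow> space N"
  shows "f \<in> measurable (completion M) N"
proof (rule measurableI)
  fix S assume S: "S \<in> sets N"
  show "f -` S \<inter> space (completion M) \<in> sets (completion M)"
  proof (rule completion.in_sets_AE)
    show "g -` S \<inter> space M \<in> sets (completion M)"
      using measurable_sets[OF g S] by auto
    show "AE x in completion M. x \<in> g -` S \<inter> space M \<longleftrightarrow> x \<in> f -` S \<inter> space (completion M)"
      using AE_completion[OF AE] by eventually_elim auto
  qed simp
qed (use f in auto)

context rooted_graph
begin

text \<open>Edges out of unplayed vertices have biased regret 0, and at most \<open>n\<close>
  vertices have been played. Hence \<open>Max\<close> in \<open>max_pos\<close> is taken over a
  finite set even when \<open>E\<close> is infinite.\<close>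

lemma finite_pos_biased_regret:
  assumes "\<And>t. 1 \<le> t \<Longrightarrow> x t \<in> V"
  shows "finite ((\<lambda>(i, j). pos (biased_regret b x w n i j)) ` E)"
proof -
  let ?A = "Sigma (x ` {1..n}) (\<lambda>i. E `` {i})"
  let ?f = "\<lambda>(i, j). pos (biased_regret b x w n i j)"
  have "finite ?A" using assms finite_out by auto
  moreover have "?f ` E \<subseteq> insert 0 (?f ` ?A)"
  proof
    fix z assume "z \<in> ?f ` E"
    then obtain i j where ij: "(i, j) \<in> E" "z = pos (biased_regret b x w n i j)" by auto
    show "z \<in> insert 0 (?f ` ?A)"
    proof (cases "i \<in> x ` {1..n}")
      case False
      hence "biased_regret b x w n i j = 0"
        unfolding biased_regret_eq_sum by (intro sum.neutral) auto
      thus ?thesis using ij by (simp add: pos_def)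
    qed (use ij in force)
  qed
  ultimately show ?thesis by (meson finite_imageI finite_insert finite_subset)
qed

text \<open>Vertices outside \<open>near L\<close> are never played and contribute no
  regret.\<close>

lemma local_swap_regret_eq_sum:
  assumes "\<And>t. t \<in> {1..n} \<Longrightarrow> x t \<in> near L"
  shows "local_swap_regret V E x w n =
    (\<Sum>i\<in>near L. Max (insert 0 ((\<lambda>j. pos (regret x w n i j)) ` (E `` {i}))))"
proof -
  have "Max (insert 0 ((\<lambda>j. pos (regret x w n i j)) ` (E `` {i}))) = 0" if "i \<notin> near L" for i
  proof -
    have "regret x w n i j = 0" for j
      using assms that unfolding regret_def by (intro sum.neutral) auto
    hence "(\<lambda>j. pos (regret x w n i j)) ` (E `` {i}) \<subseteq> {0}" by (auto simp: pos_def)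
    hence "insert 0 ((\<lambda>j. pos (regret x w n i j)) ` (E `` {i})) = {0}" by blast
    thus ?thesis by (simp only: Max_singleton)
  qed
  hence "local_swap_regret V E x w n =
      (\<Sum>\<^sub>\<infinity>i\<in>near L. Max (insert 0 ((\<lambda>j. pos (regret x w n i j)) ` (E `` {i}))))"
    unfolding local_swap_regret_def using near_subset by (intro infsum_cong_neutral) auto
  thus ?thesis using finite_near by simp
qed

text \<open>Regret exceeds biased regret by \<open>b\<close> for every play of \<open>i\<close>, and
  the maximum over out-neighbours is at most the sum of positive parts. Each round plays at most one
  vertex of \<open>near L\<close>, so these charges sum to at most
  \<open>b * real n\<close>.\<close>

lemma sum_Max_regret_le:
  assumes b: "0 \<le> b"
  shows "(\<Sum>i\<in>near L. Max (insert 0 ((\<lambda>j. pos (regret x w n i j)) ` (E `` {i}))))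
    \<le> b * real n + (\<Sum>(i, j)\<in>edges_upto_level E root L. pos (biased_regret b x w n i j))"
proof -
  let ?N = "\<lambda>i. \<Sum>t=1..n. of_bool (x t = i) :: real"
  let ?B = "\<lambda>i j. pos (biased_regret b x w n i j)"
  have "(\<Sum>i\<in>near L. Max (insert 0 ((\<lambda>j. pos (regret x w n i j)) ` (E `` {i}))))
      \<le> (\<Sum>i\<in>near L. b * ?N i + (\<Sum>j\<in>E `` {i}. ?B i j))"
  proof (rule sum_mono)
    fix i assume i: "i \<in> near L"
    note fin = finite_out_near[OF i]
    have N0: "0 \<le> b * ?N i" using b by (intro mult_nonneg_nonneg sum_nonneg) auto
    have "pos (regret x w n i j) \<le> b * ?N i + (\<Sum>j\<in>E `` {i}. ?B i j)" if "j \<in> E `` {i}" for j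
    proof -
      have "pos (regret x w n i j) \<le> b * ?N i + ?B i j"
        using N0 by (simp add: regret_eq_biased_regret[of _ _ _ _ _ b] pos_def)
      also have "?B i j \<le> (\<Sum>j\<in>E `` {i}. ?B i j)" using fin that by (intro member_le_sum) auto
      finally show ?thesis by simp
    qed
    thus "Max (insert 0 ((\<lambda>j. pos (regret x w n i j)) ` (E `` {i}))) \<le> b * ?N i + (\<Sum>j\<in>E `` {i}. ?B i j)"
      using fin N0 by (subst Max_le_iff) (auto intro!: add_nonneg_nonneg sum_nonneg)
  qed
  also have "\<dots> = b * (\<Sum>t=1..n. \<Sum>i\<in>near L. of_bool (x t = i)) + (\<Sum>i\<in>near L. \<Sum>j\<in>E `` {i}. ?B i j)"
    by (simp add: sum.distrib sum_distrib_left[symmetric] sum.swap[of _ "near L"])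
  also have "\<dots> \<le> b * (\<Sum>t=1..n. 1) + (\<Sum>i\<in>near L. \<Sum>j\<in>E `` {i}. ?B i j)"
    using b sum_of_bool_le_1[OF finite_near] by (intro add_right_mono mult_left_mono sum_mono) auto
  finally show ?thesis by (simp add: sum_edges_upto_level)
qed

end

section \<open>Change of the potential in one round\<close>

locale matching_play = online_play M V a u p + rooted_graph V E root
  for M :: "'w measure" and V :: "'v set" and a u p and E :: "('v \<times> 'v) set" and root +
  fixes D L :: nat and \<Delta> :: real
  assumes out_degree: "v \<in> V \<Longrightarrow> card (E `` {v}) \<le> D"
    and utility_range: "t \<ge> 1 \<Longrightarrow> \<omega> \<in> space M \<Longrightarrow> i \<in> V \<Longrightarrow> j \<in> V \<Longrightarrow> \<bar>u t \<omega> i - u t \<omega> j\<bar> \<le> \<Delta>"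
    and matching: "\<omega> \<in> space M \<Longrightarrow>
      regret_matching V E root (\<Delta> / real (L + 1)) L (\<lambda>t. a t \<omega>) (\<lambda>t. u t \<omega>) (\<lambda>t. p t \<omega>)"
begin

definition bias :: real where
  "bias = \<Delta> / real (L + 1)"

definition biased :: "nat \<Rightarrow> 'w \<Rightarrow> 'v \<Rightarrow> 'v \<Rightarrow> real" where
  "biased t \<omega> = biased_regret bias (\<lambda>t. a t \<omega>) (\<lambda>t. u t \<omega>) t"

definition gain :: "nat \<Rightarrow> 'w \<Rightarrow> 'v \<Rightarrow> 'v \<Rightarrow> real" where
  "gain t \<omega> i j = u t \<omega> j - u t \<omega> i - bias"

definition total_potential :: "nat \<Rightarrow> 'w \<Rightarrow> real" where
  "total_potential t \<omega> = (\<Sum>i\<in>near L. \<Sum>j\<in>E `` {i}. potential bias (biased t \<omega> i j))"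

text \<open>The linear term of \<open>potential_step\<close>, summed over the edges out of
  \<open>i\<close>, for the case that \<open>i\<close> is the action of round
  \<open>Suc t\<close>.\<close>

definition drift :: "nat \<Rightarrow> 'w \<Rightarrow> 'v \<Rightarrow> real" where
  "drift t \<omega> i = (\<Sum>j\<in>E `` {i}. 2 * pos (biased t \<omega> i j) * gain (Suc t) \<omega> i j)"

lemma Delta_nonneg: "0 \<le> \<Delta>"
proof -
  obtain \<omega> where "\<omega> \<in> space M" using not_empty by blast
  thus ?thesis using utility_range[of 1 \<omega> root root] root_in by simp
qed

lemma bias_nonneg: "0 \<le> bias"
  using Delta_nonneg by (simp add: bias_def)

lemma action_in: "t \<ge> 1 \<Longrightarrow> \<omega> \<in> space M \<Longrightarrow> a t \<omega> \<in> V"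
  using action_measurable[THEN measurable_space] by auto

lemma stationary_play:
  "\<omega> \<in> space M \<Longrightarrow> stationary V E root L (biased t \<omega>) (p (Suc t) \<omega>)"
  using matching[of \<omega>] unfolding regret_matching_def biased_def bias_def by (metis diff_Suc_1 le_add1 plus_1_eq_Suc)

lemma edge_in: "j \<in> E `` {i} \<Longrightarrow> i \<in> V \<and> j \<in> V"
  using edges by auto

lemma abs_gain_le:
  assumes "t \<ge> 1" "\<omega> \<in> space M" "j \<in> E `` {i}"
  shows "\<bar>gain t \<omega> i j\<bar> \<le> \<Delta> + bias"
  using utility_range[OF assms(1,2), of j i] edge_in[OF assms(3)] bias_nonneg by (simp add: gain_def)

lemma abs_biased_le:
  assumes "\<omega> \<in> space M" "j \<in> E `` {i}"
  shows "\<bar>biased t \<omega> i j\<bar> \<le> real t * (\<Delta> + bias)"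
  unfolding biased_def using abs_gain_le[OF _ assms] Delta_nonneg bias_nonneg
  by (intro abs_biased_regret_le) (auto simp: gain_def)

lemma pos_biased_le:
  assumes "\<omega> \<in> space M" "j \<in> E `` {i}"
  shows "pos (biased t \<omega> i j) \<le> real t * (\<Delta> + bias)"
  using abs_biased_le[OF assms] pos_le_abs order_trans by blast

text \<open>A round changes only the edges out of the one action played, at most \<open>D\<close>
  many, and each of them costs at most \<open>\<Delta>\<^sup>2\<close> beyond the linear
  term.\<close>

lemma total_potential_step:
  assumes \<omega>: "\<omega> \<in> space M"
  shows "total_potential (Suc t) \<omega> \<le>
    total_potential t \<omega> + (\<Sum>i\<in>near L. drift t \<omega> i * of_bool (a (Suc t) \<omega> = i)) + real D * \<Delta>\<^sup>2"
proof -
  have "(\<Sum>j\<in>E `` {i}. potential bias (biased (Suc t) \<omega> i j)) \<le>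
     (\<Sum>j\<in>E `` {i}. potential bias (biased t \<omega> i j)) + drift t \<omega> i * of_bool (a (Suc t) \<omega> = i)
       + of_bool (a (Suc t) \<omega> = i) * (real D * \<Delta>\<^sup>2)" if i: "i \<in> near L" for i
  proof (cases "a (Suc t) \<omega> = i")
    case True
    have "(\<Sum>j\<in>E `` {i}. potential bias (biased (Suc t) \<omega> i j)) \<le>
       (\<Sum>j\<in>E `` {i}. potential bias (biased t \<omega> i j) + 2 * pos (biased t \<omega> i j) * gain (Suc t) \<omega> i j + \<Delta>\<^sup>2)"
    proof (rule sum_mono)
      fix j assume j: "j \<in> E `` {i}"
      have "biased (Suc t) \<omega> i j = biased t \<omega> i j + gain (Suc t) \<omega> i j"
        using True by (simp add: biased_def gain_def)
      moreover have "\<bar>gain (Suc t) \<omega> i j + bias\<bar> \<le> \<Delta>"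
        using utility_range[of "Suc t" \<omega> j i] \<omega> edge_in[OF j] by (simp add: gain_def)
      ultimately show "potential bias (biased (Suc t) \<omega> i j) \<le>
        potential bias (biased t \<omega> i j) + 2 * pos (biased t \<omega> i j) * gain (Suc t) \<omega> i j + \<Delta>\<^sup>2"
        using potential_step[OF bias_nonneg] by simp
    qed
    also have "\<dots> = (\<Sum>j\<in>E `` {i}. potential bias (biased t \<omega> i j)) + drift t \<omega> i + real (card (E `` {i})) * \<Delta>\<^sup>2"
      by (simp add: sum.distrib drift_def)
    also have "real (card (E `` {i})) * \<Delta>\<^sup>2 \<le> real D * \<Delta>\<^sup>2"
      using out_degree[of i] i near_subset by (intro mult_right_mono) auto
    finally show ?thesis using True by simp
  next
    case False
    thus ?thesis by (simp add: biased_def)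
  qed
  hence "total_potential (Suc t) \<omega> \<le> (\<Sum>i\<in>near L. (\<Sum>j\<in>E `` {i}. potential bias (biased t \<omega> i j))
      + drift t \<omega> i * of_bool (a (Suc t) \<omega> = i) + of_bool (a (Suc t) \<omega> = i) * (real D * \<Delta>\<^sup>2))"
    unfolding total_potential_def by (rule sum_mono)
  also have "\<dots> = total_potential t \<omega> + (\<Sum>i\<in>near L. drift t \<omega> i * of_bool (a (Suc t) \<omega> = i))
      + (\<Sum>i\<in>near L. of_bool (a (Suc t) \<omega> = i)) * (real D * \<Delta>\<^sup>2)"
    by (simp only: sum.distrib total_potential_def sum_distrib_right)
  also have "(\<Sum>i\<in>near L. of_bool (a (Suc t) \<omega> = i)) * (real D * \<Delta>\<^sup>2) \<le> 1 * (real D * \<Delta>\<^sup>2)"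
    by (intro mult_right_mono sum_of_bool_le_1 finite_near) auto
  finally show ?thesis by simp
qed

text \<open>This holds at every outcome, before expectations are taken:
  \<open>stationary_drift\<close> works for any utility function of range at most \<Delta>, so an
  adaptive choice of the utilities is covered.\<close>

lemma expected_drift_nonpos:
  assumes \<omega>: "\<omega> \<in> space M"
  shows "(\<Sum>i\<in>near L. drift t \<omega> i * p (Suc t) \<omega> i) \<le> 0"
proof -
  have fin: "finite ((\<lambda>(i, j). pos (biased t \<omega> i j)) ` E)"
    unfolding biased_def using action_in \<omega> by (intro finite_pos_biased_regret) auto
  have "(\<Sum>i\<in>near L. p (Suc t) \<omega> i * (\<Sum>j\<in>E `` {i}. pos (biased t \<omega> i j) * gain (Suc t) \<omega> i j)) \<le> 0"
    unfolding gain_def bias_def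
    using stationary_drift[OF stationary_play[OF \<omega>] _ fin, where w = "u (Suc t) \<omega>" and \<Delta> = \<Delta>]
      utility_range \<omega> by simp
  moreover have "(\<Sum>i\<in>near L. drift t \<omega> i * p (Suc t) \<omega> i) =
     2 * (\<Sum>i\<in>near L. p (Suc t) \<omega> i * (\<Sum>j\<in>E `` {i}. pos (biased t \<omega> i j) * gain (Suc t) \<omega> i j))"
    by (simp add: drift_def sum_distrib_left sum_distrib_right mult_ac)
  ultimately show ?thesis by simp
qed

section \<open>Measurability with respect to the past and the current utility\<close>

lemma history_measurable: "history V a u t \<in> measurable M (history_space V t)"
  unfolding history_def history_space_def utility_space_def
  using action_measurable utility_measurable
  by (intro measurable_restrict measurable_Pair) auto

lemma history_utility_measurable:
  assumes "t \<ge> 1"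
  shows "(\<lambda>\<omega>. (history V a u t \<omega>, restrict (u t \<omega>) V)) \<in> measurable M (history_space V t \<Otimes>\<^sub>M utility_space V)"
  using assms history_measurable utility_measurable unfolding utility_space_def
  by (intro measurable_Pair measurable_restrict) auto

lemma subalgebra_past_and_utility:
  "t \<ge> 1 \<Longrightarrow> subalgebra M (past_and_utility M V a u t)"
  unfolding subalgebra_def past_and_utility_def
  using sets_image_in_sets[OF refl history_utility_measurable] by simp

text \<open>Actions are recovered only for times strictly before \<open>t\<close>, utilities up to
  and including \<open>t\<close>: exactly what is fixed when the action of time \<open>t\<close> is
  drawn. All are projections of the map that generates the sigma-algebra.\<close>

lemma past_and_utility_measurable:
  assumes t: "t \<ge> 1"
  shows past_action_measurable: "1 \<le> s \<Longrightarrow> s < t \<Longrightarrow> a s \<in> measurable (past_and_utility M V a u t) (count_space V)"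
    and past_utility_measurable: "1 \<le> s \<Longrightarrow> s \<le> t \<Longrightarrow> v \<in> V \<Longrightarrow>
      (\<lambda>\<omega>. u s \<omega> v) \<in> borel_measurable (past_and_utility M V a u t)"
proof -
  let ?h = "\<lambda>\<omega>. (history V a u t \<omega>, restrict (u t \<omega>) V)"
  let ?F = "past_and_utility M V a u t"
  have h: "?h \<in> measurable ?F (history_space V t \<Otimes>\<^sub>M utility_space V)"
    unfolding past_and_utility_def
    using history_utility_measurable[OF t, THEN measurable_space] by (intro measurable_vimage_algebra1) auto
  have step: "(\<lambda>\<omega>. history V a u t \<omega> s) \<in> measurable ?F (count_space V \<Otimes>\<^sub>M utility_space V)"
    if "1 \<le> s" "s < t" for s
  proof -
    have "(\<lambda>\<omega>. fst (?h \<omega>)) \<in> measurable ?F (history_space V t)"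
      using h by (rule measurable_compose[OF _ measurable_fst])
    hence "(\<lambda>\<omega>. fst (?h \<omega>) s) \<in> measurable ?F (count_space V \<Otimes>\<^sub>M utility_space V)"
      unfolding history_space_def
      by (rule measurable_compose[OF _ measurable_component_singleton]) (use that in auto)
    thus ?thesis by simp
  qed
  show "a s \<in> measurable ?F (count_space V)" if s: "1 \<le> s" "s < t"
    using measurable_compose[OF step[OF s] measurable_fst] s by (simp add: history_def)
  show "(\<lambda>\<omega>. u s \<omega> v) \<in> borel_measurable ?F" if s: "1 \<le> s" "s \<le> t" "v \<in> V"
  proof -
    have "(\<lambda>\<omega>. restrict (u s \<omega>) V) \<in> measurable ?F (utility_space V)"
    \<comment> \<open>The utility of time \<open>t\<close> sits in the second component, earlier
      ones in the history.\<close>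
    proof (cases "s = t")
      case True
      thus ?thesis using measurable_compose[OF h measurable_snd] by simp
    next
      case False
      hence "s < t" using s by simp
      thus ?thesis using measurable_compose[OF step measurable_snd] s by (simp add: history_def)
    qed
    from measurable_compose[OF this[unfolded utility_space_def] measurable_component_singleton[OF s(3)]]
    show ?thesis using s by simp
  qed
qed

text \<open>The measurable space \<open>N\<close> is left open because both \<open>M\<close> and the
  smaller sigma-algebra \<open>past_and_utility\<close> are needed.\<close>

lemma biased_measurable:
  assumes "\<And>s. 1 \<le> s \<Longrightarrow> s \<le> t \<Longrightarrow> a s \<in> measurable N (count_space V)"
    and "\<And>s v. 1 \<le> s \<Longrightarrow> s \<le> t \<Longrightarrow> v \<in> V \<Longrightarrow> (\<lambda>\<omega>. u s \<omega> v) \<in> borel_measurable N"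
    and "j \<in> E `` {i}"
  shows "(\<lambda>\<omega>. biased t \<omega> i j) \<in> borel_measurable N"
  unfolding biased_def biased_regret_eq_sum
proof (intro borel_measurable_sum borel_measurable_times borel_measurable_diff borel_measurable_const)
  fix s assume s: "s \<in> {1..t}"
  show "(\<lambda>\<omega>. of_bool (a s \<omega> = i)) \<in> borel_measurable N"
    using s assms(1) by (intro measurable_compose[where f = "a s" and g = "\<lambda>v. of_bool (v = i)"]) auto
  show "(\<lambda>\<omega>. u s \<omega> j) \<in> borel_measurable N" "(\<lambda>\<omega>. u s \<omega> i) \<in> borel_measurable N"
    using s assms(2) edge_in[OF assms(3)] by auto
qed

lemma biased_measurable_M: "j \<in> E `` {i} \<Longrightarrow> (\<lambda>\<omega>. biased t \<omega> i j) \<in> borel_measurable M"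
  using action_measurable utility_measurable by (intro biased_measurable) auto

lemma pos_measurable [measurable]: "pos \<in> borel_measurable borel"
  unfolding pos_def by measurable

lemma potential_measurable [measurable]: "potential b \<in> borel_measurable borel"
  unfolding potential_def by measurable

section \<open>Expected growth of the potential\<close>

lemma total_potential_integrable: "integrable M (total_potential t)"
  unfolding total_potential_def
proof (intro Bochner_Integration.integrable_sum)
  fix i j assume j: "j \<in> E `` {i}"
  let ?C = "real t * (\<Delta> + bias)"
  show "integrable M (\<lambda>\<omega>. potential bias (biased t \<omega> i j))"
  proof (rule integrable_const_bound)
    show "AE \<omega> in M. norm (potential bias (biased t \<omega> i j)) \<le> ?C\<^sup>2 + 2 * bias * ?C"
      using pos_biased_le[OF _ j] bias_nonneg
      by (auto intro!: AE_I2 add_mono power_mono mult_left_mono simp: potential_def)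
    show "(\<lambda>\<omega>. potential bias (biased t \<omega> i j)) \<in> borel_measurable M"
      using biased_measurable_M[OF j] by (rule measurable_compose) measurable
  qed
qed

text \<open>The biased regrets after \<open>t\<close> rounds involve only actions before time
  \<open>Suc t\<close>, and the utility of time \<open>Suc t\<close> is part of the sigma-algebra;
  the drift is therefore known before the action is drawn.\<close>

lemma drift_measurable: "(\<lambda>\<omega>. drift t \<omega> i) \<in> borel_measurable (past_and_utility M V a u (Suc t))"
  unfolding drift_def gain_def
proof (intro borel_measurable_sum borel_measurable_times borel_measurable_diff borel_measurable_const)
  fix j assume j: "j \<in> E `` {i}"
  have "(\<lambda>\<omega>. biased t \<omega> i j) \<in> borel_measurable (past_and_utility M V a u (Suc t))"
    using past_and_utility_measurable[of "Suc t"] j by (intro biased_measurable) auto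
  thus "(\<lambda>\<omega>. pos (biased t \<omega> i j)) \<in> borel_measurable (past_and_utility M V a u (Suc t))"
    by (rule measurable_compose) measurable
qed (use past_utility_measurable[of "Suc t" "Suc t"] edge_in in auto)

lemma action_event: "t \<ge> 1 \<Longrightarrow> i \<in> V \<Longrightarrow> {\<omega> \<in> space M. a t \<omega> = i} \<in> sets M"
  using measurable_sets[OF action_measurable, of t "{i}"] by (simp add: vimage_def Int_def conj_commute)

lemma drift_bounded: "\<exists>C. \<forall>\<omega>\<in>space M. \<bar>drift t \<omega> i\<bar> \<le> C"
proof (intro exI ballI)
  fix \<omega> assume \<omega>: "\<omega> \<in> space M"
  show "\<bar>drift t \<omega> i\<bar> \<le> (\<Sum>j\<in>E `` {i}. 2 * (real t * (\<Delta> + bias)) * (\<Delta> + bias))"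
    unfolding drift_def
  proof (rule order_trans[OF sum_abs sum_mono])
    fix j assume j: "j \<in> E `` {i}"
    show "\<bar>2 * pos (biased t \<omega> i j) * gain (Suc t) \<omega> i j\<bar> \<le> 2 * (real t * (\<Delta> + bias)) * (\<Delta> + bias)"
      unfolding abs_mult using pos_biased_le[OF \<omega> j] abs_gain_le[OF _ \<omega> j] Delta_nonneg bias_nonneg
      by (intro mult_mono) auto
  qed
qed

text \<open>Being bounded and measurable for \<open>F\<close>, the drift can be integrated against
  the conditional expectation of the action's indicator instead of the indicator itself.\<close>

lemma drift_action:
  fixes t :: nat
  defines "F \<equiv> past_and_utility M V a u (Suc t)"
  defines "A \<equiv> \<lambda>i. indicator {\<omega> \<in> space M. a (Suc t) \<omega> = i} :: 'w \<Rightarrow> real"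
  assumes i: "i \<in> near L"
  shows "integrable M (\<lambda>\<omega>. drift t \<omega> i * A i \<omega>)"
    and "integrable M (\<lambda>\<omega>. drift t \<omega> i * real_cond_exp M F (A i) \<omega>)"
    and "(\<integral>\<omega>. drift t \<omega> i * real_cond_exp M F (A i) \<omega> \<partial>M) = (\<integral>\<omega>. drift t \<omega> i * A i \<omega> \<partial>M)"
proof -
  interpret finite_measure_subalgebra M F
    using subalgebra_past_and_utility[of "Suc t"] by unfold_locales (simp add: F_def)
  have meas: "(\<lambda>\<omega>. drift t \<omega> i) \<in> borel_measurable F" using drift_measurable by (simp add: F_def)
  have A: "A i \<in> borel_measurable M"
    unfolding A_def using action_event[of "Suc t" i] i near_subset by (intro borel_measurable_indicator) auto
  obtain C where C: "\<And>\<omega>. \<omega> \<in> space M \<Longrightarrow> \<bar>drift t \<omega> i\<bar> \<le> C" using drift_bounded by blast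
  show int: "integrable M (\<lambda>\<omega>. drift t \<omega> i * A i \<omega>)"
  proof (rule integrable_const_bound)
    show "AE \<omega> in M. norm (drift t \<omega> i * A i \<omega>) \<le> C"
    proof (rule AE_I2)
      fix \<omega> assume "\<omega> \<in> space M"
      thus "norm (drift t \<omega> i * A i \<omega>) \<le> C"
        using C[of \<omega>] abs_ge_zero[of "drift t \<omega> i"] by (auto simp: A_def indicator_def abs_mult)
    qed
    show "(\<lambda>\<omega>. drift t \<omega> i * A i \<omega>) \<in> borel_measurable M"
      using A measurable_from_subalg[OF subalg meas] by (rule borel_measurable_times[rotated])
  qed
  show "integrable M (\<lambda>\<omega>. drift t \<omega> i * real_cond_exp M F (A i) \<omega>)"
    and "(\<integral>\<omega>. drift t \<omega> i * real_cond_exp M F (A i) \<omega> \<partial>M) = (\<integral>\<omega>. drift t \<omega> i * A i \<omega> \<partial>M)"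
    using real_cond_exp_intg[OF int meas A] by auto
qed

text \<open>The indicators are exchanged for their conditional expectations, which equal
  \<open>p\<close> almost surely by the action law; then \<open>expected_drift_nonpos\<close> makes
  the integrand nonpositive.\<close>

lemma expectation_drift_nonpos:
  "(\<integral>\<omega>. (\<Sum>i\<in>near L. drift t \<omega> i * of_bool (a (Suc t) \<omega> = i)) \<partial>M) \<le> 0"
  (is "integral\<^sup>L M ?f \<le> 0")
  and integrable_drift: "integrable M (\<lambda>\<omega>. \<Sum>i\<in>near L. drift t \<omega> i * of_bool (a (Suc t) \<omega> = i))"
proof -
  define F where "F = past_and_utility M V a u (Suc t)"
  define A where "A i = (indicator {\<omega> \<in> space M. a (Suc t) \<omega> = i} :: 'w \<Rightarrow> real)" for i
  note da = drift_action[where t = t, folded F_def, folded A_def]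
  have eq: "?f \<omega> = (\<Sum>i\<in>near L. drift t \<omega> i * A i \<omega>)" if "\<omega> \<in> space M" for \<omega>
    using that by (intro sum.cong) (auto simp: A_def indicator_def)
  have "integrable M (\<lambda>\<omega>. \<Sum>i\<in>near L. drift t \<omega> i * A i \<omega>)" using da(1) by auto
  thus "integrable M ?f" using eq by (simp cong: Bochner_Integration.integrable_cong)
  have "integral\<^sup>L M ?f = (\<integral>\<omega>. (\<Sum>i\<in>near L. drift t \<omega> i * A i \<omega>) \<partial>M)"
    using eq by (intro Bochner_Integration.integral_cong) auto
  also have "\<dots> = (\<Sum>i\<in>near L. \<integral>\<omega>. drift t \<omega> i * A i \<omega> \<partial>M)"
    using da(1) by (rule Bochner_Integration.integral_sum)
  also have "\<dots> = (\<Sum>i\<in>near L. \<integral>\<omega>. drift t \<omega> i * real_cond_exp M F (A i) \<omega> \<partial>M)"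
    using da(3) by simp
  also have "\<dots> = (\<integral>\<omega>. (\<Sum>i\<in>near L. drift t \<omega> i * real_cond_exp M F (A i) \<omega>) \<partial>M)"
    using da(2) by (rule Bochner_Integration.integral_sum[symmetric])
  also have "\<dots> \<le> 0"
  proof -
    \<comment> \<open>\<open>near L\<close> is finite, so one null set serves all its
      vertices.\<close>
    have "AE \<omega> in M. \<forall>i\<in>near L. real_cond_exp M F (A i) \<omega> = p (Suc t) \<omega> i"
      using action_law[of "Suc t"] near_subset
      by (intro AE_finite_allI finite_near) (auto simp: F_def A_def)
    hence "AE \<omega> in M. 0 \<le> - (\<Sum>i\<in>near L. drift t \<omega> i * real_cond_exp M F (A i) \<omega>)"
    proof (rule AE_mp, intro AE_I2 impI)
      fix \<omega> assume "\<omega> \<in> space M" "\<forall>i\<in>near L. real_cond_exp M F (A i) \<omega> = p (Suc t) \<omega> i"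
      thus "0 \<le> - (\<Sum>i\<in>near L. drift t \<omega> i * real_cond_exp M F (A i) \<omega>)"
        using expected_drift_nonpos[of \<omega> t] by simp
    qed
    from integral_nonneg_AE[OF this] show ?thesis by simp
  qed
  finally show "integral\<^sup>L M ?f \<le> 0" .
qed

lemma expectation_total_potential_le:
  "expectation (total_potential t) \<le> real t * (real D * \<Delta>\<^sup>2)"
proof (induction t)
  case 0
  show ?case by (simp add: total_potential_def[abs_def] biased_def potential_def pos_def)
next
  case (Suc t)
  let ?f = "\<lambda>\<omega>. \<Sum>i\<in>near L. drift t \<omega> i * of_bool (a (Suc t) \<omega> = i)"
  have "expectation (total_potential (Suc t)) \<le>
      (\<integral>\<omega>. total_potential t \<omega> + ?f \<omega> + real D * \<Delta>\<^sup>2 \<partial>M)"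
    using total_potential_step total_potential_integrable integrable_drift
    by (intro integral_mono) auto
  also have "\<dots> = expectation (total_potential t) + integral\<^sup>L M ?f + real D * \<Delta>\<^sup>2"
    using total_potential_integrable integrable_drift by (simp add: prob_space)
  finally show ?case using Suc expectation_drift_nonpos[of t] by (simp add: algebra_simps)
qed

text \<open>The probabilities of the disjoint events for \<open>i\<close> in \<open>near L\<close>
  add up to 1, because their conditional versions are the entries of \<open>p t\<close>. Excluding
  the actions outside \<open>near L\<close> one by one could involve uncountably many null
  sets.\<close>

lemma AE_action_near:
  assumes t: "t \<ge> 1"
  shows "AE \<omega> in M. a t \<omega> \<in> near L"
proof -
  define F where "F = past_and_utility M V a u t"
  define A where "A i = {\<omega> \<in> space M. a t \<omega> = i}" for i
  interpret finite_measure_subalgebra M F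
    using subalgebra_past_and_utility[OF t] by unfold_locales (simp add: F_def)
  have A: "A i \<in> sets M" if "i \<in> near L" for i
    unfolding A_def using action_event[OF t] that near_subset by auto
  have int: "integrable M (indicator (A i) :: 'w \<Rightarrow> real)" if "i \<in> near L" for i
    using A[OF that] by (simp add: less_top[symmetric])
  have "prob (\<Union>i\<in>near L. A i) = (\<Sum>i\<in>near L. prob (A i))"
    using A finite_near by (intro finite_measure_finite_Union) (auto simp: disjoint_family_on_def A_def)
  also have "\<dots> = (\<Sum>i\<in>near L. \<integral>\<omega>. real_cond_exp M F (indicator (A i)) \<omega> \<partial>M)"
    using A real_cond_exp_int(2)[OF int] by (intro sum.cong) auto
  also have "\<dots> = (\<integral>\<omega>. (\<Sum>i\<in>near L. real_cond_exp M F (indicator (A i)) \<omega>) \<partial>M)"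
    using real_cond_exp_int(1)[OF int] by (rule Bochner_Integration.integral_sum[symmetric])
  also have "\<dots> = (\<integral>\<omega>. 1 \<partial>M)"
  proof (rule integral_cong_AE)
    have "AE \<omega> in M. \<forall>i\<in>near L. real_cond_exp M F (indicator (A i)) \<omega> = p t \<omega> i"
      using action_law[OF t] near_subset by (intro AE_finite_allI finite_near) (auto simp: F_def A_def)
    thus "AE \<omega> in M. (\<Sum>i\<in>near L. real_cond_exp M F (indicator (A i)) \<omega>) = 1"
    proof (rule AE_mp, intro AE_I2 impI)
      fix \<omega> assume "\<omega> \<in> space M" "\<forall>i\<in>near L. real_cond_exp M F (indicator (A i)) \<omega> = p t \<omega> i"
      thus "(\<Sum>i\<in>near L. real_cond_exp M F (indicator (A i)) \<omega>) = 1"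
        \<comment> \<open>\<open>p t\<close> is stationary for the biased regrets after
          \<open>t - 1\<close> rounds.\<close>
        using stationary_sum[OF stationary_play[of \<omega> "t - 1"]] t by simp
    qed
  qed (auto intro!: borel_measurable_sum)
  finally have "prob (\<Union>i\<in>near L. A i) = 1" by (simp add: prob_space)
  from AE_prob_1[OF this] show ?thesis by (auto simp: A_def)
qed

section \<open>From the potential to the local swap regret\<close>

lemma expectation_sum_pos_biased_le:
  fixes T :: nat
  defines "X \<equiv> \<lambda>\<omega>. \<Sum>(i, j)\<in>edges_upto_level E root L. pos (biased T \<omega> i j)"
  shows "integrable M X"
    and "expectation X \<le> \<Delta> * sqrt (real D * real (card (edges_upto_level E root L))) * sqrt (real T)"
proof -
  let ?EL = "edges_upto_level E root L"
  let ?C = "real T * (\<Delta> + bias)"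
  have out: "j \<in> E `` {i}" if "(i, j) \<in> ?EL" for i j using that by (auto simp: edges_upto_level_def)
  have X_meas: "X \<in> borel_measurable M"
    unfolding X_def
  proof (intro borel_measurable_sum, clarify)
    fix i j assume "(i, j) \<in> ?EL"
    from biased_measurable_M[OF out[OF this]]
    show "(\<lambda>\<omega>. pos (biased T \<omega> i j)) \<in> borel_measurable M" by (rule measurable_compose) measurable
  qed
  have X0: "0 \<le> X \<omega>" for \<omega> unfolding X_def by (intro sum_nonneg) auto
  have X_sq: "(X \<omega>)\<^sup>2 \<le> total_potential T \<omega> * real (card ?EL)" for \<omega>
  proof -
    \<comment> \<open>Cauchy--Schwarz over the edges; the potential then dominates the sum of
      squares.\<close>
    have "(X \<omega>)\<^sup>2 \<le> (\<Sum>(i, j)\<in>?EL. (pos (biased T \<omega> i j))\<^sup>2) * real (card ?EL)"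
      using sum_squared_le_sum_of_squares[of "\<lambda>(i, j). pos (biased T \<omega> i j)" ?EL]
      by (simp add: X_def case_prod_unfold)
    also have "(\<Sum>(i, j)\<in>?EL. (pos (biased T \<omega> i j))\<^sup>2) \<le> (\<Sum>(i, j)\<in>?EL. potential bias (biased T \<omega> i j))"
      using pos_sq_le_potential[OF bias_nonneg] by (intro sum_mono) auto
    also have "\<dots> = total_potential T \<omega>" by (simp add: sum_edges_upto_level total_potential_def)
    finally show ?thesis by (simp add: mult_right_mono)
  qed
  have int_sq: "integrable M (\<lambda>\<omega>. (X \<omega>)\<^sup>2)"
  proof (rule Bochner_Integration.integrable_bound)
    show "integrable M (\<lambda>\<omega>. total_potential T \<omega> * real (card ?EL))" using total_potential_integrable by simp
    show "AE \<omega> in M. norm ((X \<omega>)\<^sup>2) \<le> norm (total_potential T \<omega> * real (card ?EL))"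
      using X_sq by (intro AE_I2) (metis abs_ge_self norm_power order_trans power2_abs real_norm_def)
  qed (use X_meas in simp)
  show int: "integrable M X"
    using int_sq X_meas square_integrable_imp_integrable by blast
  \<comment> \<open>The variance is nonnegative, so the second moment bounds the squared
    mean.\<close>
  have "(expectation X)\<^sup>2 \<le> expectation (\<lambda>\<omega>. (X \<omega>)\<^sup>2)"
    using variance_eq[OF int int_sq] variance_positive[of X] by simp
  also have "\<dots> \<le> (\<integral>\<omega>. total_potential T \<omega> * real (card ?EL) \<partial>M)"
    using int_sq X_sq total_potential_integrable by (intro integral_mono) auto
  also have "\<dots> \<le> real T * (real D * \<Delta>\<^sup>2) * real (card ?EL)"
    using expectation_total_potential_le[of T] by (simp add: mult_right_mono)
  also have "\<dots> = (\<Delta> * sqrt (real D * real (card ?EL)) * sqrt (real T))\<^sup>2"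
    by (simp add: power_mult_distrib)
  finally show "expectation X \<le> \<Delta> * sqrt (real D * real (card ?EL)) * sqrt (real T)"
    by (rule power2_le_imp_le) (use Delta_nonneg in simp)
qed

text \<open>The regret \<open>Y\<close> need not be measurable for \<open>M\<close>, but it agrees
  almost surely with the finite sum \<open>Z\<close>, which is. All estimates are made for
  \<open>Z\<close> under \<open>M\<close> and carried over to the completion.\<close>

lemma local_swap_regret_bound:
  assumes T: "T \<ge> 1"
  shows "integrable (completion M) (\<lambda>\<omega>. local_swap_regret V E (\<lambda>t. a t \<omega>) (\<lambda>t. u t \<omega>) T)"
    and "expected_local_swap_regret M V E a u T \<le>
      bias * real T + \<Delta> * sqrt (real D * real (card (edges_upto_level E root L))) * sqrt (real T)"
proof -
  define Y where "Y \<omega> = local_swap_regret V E (\<lambda>t. a t \<omega>) (\<lambda>t. u t \<omega>) T" for \<omega>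
  define Z where "Z \<omega> = (\<Sum>i\<in>near L. Max (insert 0
      ((\<lambda>j. pos (regret (\<lambda>t. a t \<omega>) (\<lambda>t. u t \<omega>) T i j)) ` (E `` {i}))))" for \<omega>
  define X where "X \<omega> = (\<Sum>(i, j)\<in>edges_upto_level E root L. pos (biased T \<omega> i j))" for \<omega>
  note X = expectation_sum_pos_biased_le[of T, folded X_def]
  have Z_le: "Z \<omega> \<le> bias * real T + X \<omega>" for \<omega>
    unfolding Z_def X_def biased_def by (rule sum_Max_regret_le[OF bias_nonneg])
  have Z_nonneg: "0 \<le> Z \<omega>" for \<omega>
    unfolding Z_def by (intro sum_nonneg Max_ge) (auto intro: finite_out_near)
  have Z_meas: "Z \<in> borel_measurable M"
    unfolding Z_def
  proof (rule borel_measurable_sum)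
    fix i assume i: "i \<in> near L"
    have m: "(\<lambda>\<omega>. pos (regret (\<lambda>t. a t \<omega>) (\<lambda>t. u t \<omega>) T i j)) \<in> borel_measurable M" if j: "j \<in> E `` {i}" for j
    proof -
      have "(\<lambda>\<omega>. regret (\<lambda>t. a t \<omega>) (\<lambda>t. u t \<omega>) T i j) \<in> borel_measurable M"
        unfolding regret_def
      proof (intro borel_measurable_sum borel_measurable_times borel_measurable_diff)
        fix s assume s: "s \<in> {1..T}"
        show "(\<lambda>\<omega>. of_bool (a s \<omega> = i)) \<in> borel_measurable M"
          using s action_measurable by (intro measurable_compose[where f = "a s" and g = "\<lambda>v. of_bool (v = i)"]) auto
        show "(\<lambda>\<omega>. u s \<omega> j) \<in> borel_measurable M" "(\<lambda>\<omega>. u s \<omega> i) \<in> borel_measurable M"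
          using s utility_measurable edge_in[OF j] by auto
      qed
      thus ?thesis by (rule measurable_compose) measurable
    qed
    show "(\<lambda>\<omega>. Max (insert 0 ((\<lambda>j. pos (regret (\<lambda>t. a t \<omega>) (\<lambda>t. u t \<omega>) T i j)) ` (E `` {i})))) \<in> borel_measurable M"
    \<comment> \<open>\<open>Max (insert 0 A)\<close> splits off \<open>Max A\<close> only for
      nonempty \<open>A\<close>; at a sink the value is constantly zero.\<close>
    proof (cases "E `` {i} = {}")
      case False
      thus ?thesis using finite_out_near[OF i] m
        by (simp add: borel_measurable_max borel_measurable_Max)
    qed simp
  qed
  have int: "integrable M Z"
  proof (rule Bochner_Integration.integrable_bound)
    show "integrable M (\<lambda>\<omega>. bias * real T + X \<omega>)" using X(1) by simp
    show "AE \<omega> in M. norm (Z \<omega>) \<le> norm (bias * real T + X \<omega>)"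
      using Z_le Z_nonneg by (intro AE_I2) (smt (verit) real_norm_def)
  qed (rule Z_meas)
  \<comment> \<open>Finitely many rounds share one null set, outside which no action leaves
    \<open>near L\<close>.\<close>
  have "AE \<omega> in M. \<forall>t\<in>{1..T}. a t \<omega> \<in> near L"
    by (intro AE_finite_allI AE_action_near) auto
  hence AE: "AE \<omega> in M. Y \<omega> = Z \<omega>"
    by eventually_elim (auto simp: Y_def Z_def intro!: local_swap_regret_eq_sum)
  have Y_meas: "Y \<in> borel_measurable (completion M)"
    using measurable_completion_cong_AE[OF Z_meas AE] by simp
  have AE': "AE \<omega> in completion M. Y \<omega> = Z \<omega>" using AE by (rule AE_completion)
  have Zc: "Z \<in> borel_measurable (completion M)" using Z_meas by (rule measurable_completion)
  have "integrable (completion M) Z" using int Z_meas by (simp add: integrable_completion)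
  thus "integrable (completion M) Y"
    using integrable_cong_AE[OF Y_meas Zc AE'] by simp
  have "expected_local_swap_regret M V E a u T = integral\<^sup>L (completion M) Y"
    by (simp add: expected_local_swap_regret_def Y_def[abs_def])
  also have "\<dots> = integral\<^sup>L (completion M) Z" by (rule integral_cong_AE[OF Y_meas Zc AE'])
  also have "\<dots> = expectation Z" by (rule integral_completion[OF Z_meas])
  also have "\<dots> \<le> (\<integral>\<omega>. bias * real T + X \<omega> \<partial>M)"
    using int X(1) Z_le by (intro integral_mono) auto
  also have "\<dots> = bias * real T + expectation X" using X(1) by (simp add: prob_space)
  finally show "expected_local_swap_regret M V E a u T \<le>
      bias * real T + \<Delta> * sqrt (real D * real (card (edges_upto_level E root L))) * sqrt (real T)"
    using X(2) by simp
qed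

end

theorem theorem2:
  fixes V :: "'v set" and E :: "('v \<times> 'v) set" and root :: 'v
    and D L T :: nat and \<Delta> :: real
    and M :: "'w measure"
    and a :: "nat \<Rightarrow> 'w \<Rightarrow> 'v"
    and u :: "nat \<Rightarrow> 'w \<Rightarrow> 'v \<Rightarrow> real"
    and p :: "nat \<Rightarrow> 'w \<Rightarrow> 'v \<Rightarrow> real"
  assumes graph: "E \<subseteq> V \<times> V"
    and degree: "has_max_out_degree V E D"
    and root: "root \<in> V"
    and play: "online_play M V a u p"
    and range: "\<And>t \<omega> i j. t \<ge> 1 \<Longrightarrow> \<omega> \<in> space M \<Longrightarrow> i \<in> V \<Longrightarrow> j \<in> V \<Longrightarrow>
                  \<bar>u t \<omega> i - u t \<omega> j\<bar> \<le> \<Delta>"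
    and matching: "\<And>\<omega>. \<omega> \<in> space M \<Longrightarrow>
                  regret_matching V E root (\<Delta> / real (L + 1)) L
                    (\<lambda>t. a t \<omega>) (\<lambda>t. u t \<omega>) (\<lambda>t. p t \<omega>)"
    and T: "T \<ge> 1"
  shows "integrable (completion M) (\<lambda>\<omega>. local_swap_regret V E (\<lambda>t. a t \<omega>) (\<lambda>t. u t \<omega>) T) \<and>
         1 / real T * expected_local_swap_regret M V E a u T
           \<le> \<Delta> / real (L + 1) + \<Delta> * sqrt (real D * real (card (edges_upto_level E root L))) / sqrt (real T)"
proof -
  interpret online_play M V a u p by (rule play)
  interpret matching_play M V a u p E root D L \<Delta>
    using graph degree root range matching by unfold_locales (auto simp: has_max_out_degree_def)
  let ?c = "\<Delta> * sqrt (real D * real (card (edges_upto_level E root L)))"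
  have "1 / real T * expected_local_swap_regret M V E a u T \<le> 1 / real T * (bias * real T + ?c * sqrt (real T))"
    using local_swap_regret_bound(2)[OF T] by (intro mult_left_mono) auto
  also have "\<dots> = bias + ?c * (sqrt (real T) / real T)" using T by (simp add: field_simps)
  also have "sqrt (real T) / real T = 1 / sqrt (real T)" using T by (simp add: field_simps)
  finally show ?thesis using local_swap_regret_bound(1)[OF T] by (simp add: bias_def)
qed

end
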